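(* Let $d\ge 1$ be an integer, let $\mathcal{F}$ be a family of $n\ge 1$ axis-parallel boxes in $\mathbb{R}^d$, and let $\alpha\in\left(1-\frac{1}{d^2},1\right]$ be a real number. If at least $\alpha\binom n2$ pairs of boxes in $\mathcal{F}$ intersect, then there exists a point of $\mathbb{R}^d$ that belongs to at least $\left(1-d\sqrt{1-\alpha}\right)n$ elements of $\mathcal{F}$.
   Context: An axis-parallel box (or box) in $\mathbb{R}^d$ is a product of $d$ bounded intervals, either all open, $(a_1,b_1)\times\cdots\times(a_d,b_d)$, or all closed, $[a_1,b_1]\times\cdots\times[a_d,b_d]$, with $a_i<b_i$ for all $i$. The statement holds both when the boxes of the family are open and when they are closed. A pair of boxes intersects if the two boxes have nonempty intersection; pairs are unordered pairs of elements of $\mathcal{F}$. *)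

theory Defs
  imports "HOL-Analysis.Analysis"
begin

definition open_axis_box :: "(real ^ 'd) set \<Rightarrow> bool" where
  "open_axis_box B \<longleftrightarrow> (\<exists>a b. (\<forall>k. a $ k < b $ k) \<and> B = box a b)"

definition closed_axis_box :: "(real ^ 'd) set \<Rightarrow> bool" where
  "closed_axis_box B \<longleftrightarrow> (\<exists>a b. (\<forall>k. a $ k < b $ k) \<and> B = cbox a b)"

text \<open>Families are indexed, so a box may occur several times and is then counted with
  multiplicity, also among the pairs; a set of boxes is the case of the identity indexing.
  A pair is a two-element set of indices.\<close>

definition intersecting_pairs :: "'i set \<Rightarrow> ('i \<Rightarrow> 'a set) \<Rightarrow> 'i set set" where
  "intersecting_pairs I B = {{i, j} | i j. i \<in> I \<and> j \<in> I \<and> i \<noteq> j \<and> B i \<inter> B j \<noteq> {}}"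

end

theory Submission
  imports Defs
begin

text \<open>Two boxes that meet have overlapping projections on every coordinate axis, so each axis
  carries a family of \<open>n\<close> intervals of which at most \<open>(1 - \<alpha>) (n choose 2)\<close> pairs are
  disjoint. On a line, few disjoint pairs force a deep point: if every point is missed by at least
  \<open>t\<close> intervals, then sweeping through the intervals by increasing left endpoint produces
  \<open>1 + 2 + \<dots> + t = (t + 1) choose 2\<close> disjoint pairs (lemma \<open>separated_pairs_lower_bound\<close>).
  Comparing both counts gives, on each axis, a point that is missed by at most
  \<open>sqrt (1 - \<alpha>) n\<close> of the intervals. The point of \<open>\<real>\<^sup>d\<close> with these coordinates is missed by at most
  \<open>d sqrt (1 - \<alpha>) n\<close> boxes.

  The sweep compares endpoints, and whether a box contains its endpoints would matter there. This
  dependence disappears when every box is first shrunk to a closed box inside it without losing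
  any intersection (lemma \<open>shrink_to_closed_boxes\<close>).\<close>

text \<open>For closed intervals \<open>{a i..b i}\<close> these are the disjoint pairs, since of two disjoint
  intervals one ends before the other begins. The two indices differ because \<open>a i \<le> b i\<close>.\<close>

definition separated_pairs :: "('i \<Rightarrow> 'a::linorder) \<Rightarrow> ('i \<Rightarrow> 'a) \<Rightarrow> 'i set \<Rightarrow> 'i set set" where
  "separated_pairs a b I = {{i, j} | i j. i \<in> I \<and> j \<in> I \<and> b i < a j}"

lemma finite_separated_pairs: "finite I \<Longrightarrow> finite (separated_pairs a b I)"
  by (rule finite_subset[of _ "Pow I"]) (auto simp: separated_pairs_def)

text \<open>The induction adds the intervals by increasing left endpoint. An earlier interval that
  misses the left endpoint of the new one lies entirely to its left. Hence the new interval is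
  disjoint from at least \<open>t\<close> earlier ones, while among the earlier ones alone every point is still
  missed at least \<open>t - 1\<close> times.\<close>

lemma separated_pairs_lower_bound:
  fixes a b :: "'i \<Rightarrow> 'a::linorder"
  assumes "finite I" and "\<And>i. i \<in> I \<Longrightarrow> a i \<le> b i"
    and "\<And>x. t \<le> card {i \<in> I. x \<notin> {a i..b i}}"
  shows "Suc t choose 2 \<le> card (separated_pairs a b I)"
  using assms
proof (induction I arbitrary: t rule: finite_ranking_induct[where f = a])
  case empty
  then show ?case by (simp add: numeral_2_eq_2)
next
  case (insert j S)
  show ?case
  proof (cases "j \<in> S")
    case True
    with insert show ?thesis by (simp add: insert_absorb)
  next
    case False
    define M where "M = {i \<in> S. b i < a j}"
    have finite_M: "finite M"
      using insert.hyps by (simp add: M_def)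
    have missed: "{i \<in> insert j S. a j \<notin> {a i..b i}} = M"
      using insert.hyps insert.prems(1) by (force simp: M_def)
    have "t \<le> card M"
      using insert.prems(2)[of "a j"] missed by simp
    have "t - 1 \<le> card {i \<in> S. x \<notin> {a i..b i}}" for x
    proof -
      have "t \<le> card {i \<in> insert j S. x \<notin> {a i..b i}}"
        by (rule insert.prems(2))
      also have "\<dots> \<le> card (insert j {i \<in> S. x \<notin> {a i..b i}})"
        using insert.hyps by (intro card_mono) auto
      also have "\<dots> \<le> Suc (card {i \<in> S. x \<notin> {a i..b i}})"
        by (rule card_insert_le_m1) auto
      finally show ?thesis by simp
    qed
    then have IH: "Suc (t - 1) choose 2 \<le> card (separated_pairs a b S)"
      using insert.IH insert.prems(1) by blast
    have "inj_on (\<lambda>i. {i, j}) M"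
      by (auto simp: inj_on_def doubleton_eq_iff)
    then have card_new: "card ((\<lambda>i. {i, j}) ` M) = card M"
      by (rule card_image)
    have disjoint: "(\<lambda>i. {i, j}) ` M \<inter> separated_pairs a b S = {}"
      using False by (auto simp: separated_pairs_def doubleton_eq_iff)
    have "Suc t choose 2 = t + (t choose 2)"
      by (simp add: numeral_2_eq_2)
    also have "\<dots> \<le> card M + card (separated_pairs a b S)"
      using \<open>t \<le> card M\<close> IH by (cases t) (auto simp: numeral_2_eq_2)
    also have "\<dots> = card ((\<lambda>i. {i, j}) ` M \<union> separated_pairs a b S)"
      using insert.hyps disjoint
      by (subst card_Un_disjoint) (auto simp: card_new finite_separated_pairs finite_M)
    also have "\<dots> \<le> card (separated_pairs a b (insert j S))"
      using insert.hyps
      by (intro card_mono finite_separated_pairs) (auto simp: M_def separated_pairs_def)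
    finally show ?thesis .
  qed
qed

text \<open>A deepest point of the line turns the preceding bound into an existence statement.\<close>

lemma exists_deep_point:
  fixes a b :: "'i \<Rightarrow> 'a::linorder"
  assumes "finite I" and "\<And>i. i \<in> I \<Longrightarrow> a i \<le> b i"
  obtains x where
    "Suc (card {i \<in> I. x \<notin> {a i..b i}}) choose 2 \<le> card (separated_pairs a b I)"
proof -
  obtain x where "\<forall>y. card {i \<in> I. x \<notin> {a i..b i}} \<le> card {i \<in> I. y \<notin> {a i..b i}}"
    using ex_has_least_nat[of "\<lambda>_. True" undefined "\<lambda>x. card {i \<in> I. x \<notin> {a i..b i}}"] by blast
  then show ?thesis
    by (intro that separated_pairs_lower_bound assms) auto
qed

lemma axis_box_nonempty: "open_axis_box B \<or> closed_axis_box B \<Longrightarrow> B \<noteq> {}"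
  unfolding open_axis_box_def closed_axis_box_def
  by (elim disjE exE conjE) (simp_all add: interval_eq_empty_cart not_le not_less less_imp_le)

text \<open>Choose one common point for each intersecting pair, a box being paired with itself as
  well, so that every box receives a point; the closed box replacing \<open>B i\<close> is the
  bounding box of the chosen points of \<open>B i\<close>. Finitely many points of an open box stay away from
  its boundary, so their bounding box lies in it as well.\<close>

lemma shrink_to_closed_boxes:
  fixes B :: "'i \<Rightarrow> (real ^ 'd) set"
  assumes "finite I"
    and boxes: "\<And>i. i \<in> I \<Longrightarrow> open_axis_box (B i) \<or> closed_axis_box (B i)"
  obtains a b :: "'i \<Rightarrow> real ^ 'd" where
    "\<And>i. i \<in> I \<Longrightarrow> cbox (a i) (b i) \<subseteq> B i"
    "\<And>i j k. \<lbrakk>i \<in> I; j \<in> I; B i \<inter> B j \<noteq> {}\<rbrakk> \<Longrightarrow> a i $ k \<le> b j $ k"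
proof -
  define p where "p i j = (SOME x. x \<in> B i \<inter> B j)" for i j
  define N where "N i = {j \<in> I. B i \<inter> B j \<noteq> {}}" for i
  define a :: "'i \<Rightarrow> real ^ 'd" where "a i = (\<chi> k. Min ((\<lambda>j. p i j $ k) ` N i))" for i
  define b :: "'i \<Rightarrow> real ^ 'd" where "b i = (\<chi> k. Max ((\<lambda>j. p i j $ k) ` N i))" for i
  \<comment> \<open>Both boxes of a pair must receive the same point.\<close>
  have p_commute: "p i j = p j i" for i j
    by (simp add: p_def Int_commute)
  have p_mem: "p i j \<in> B i" if "j \<in> N i" for i j
  proof -
    have "\<exists>x. x \<in> B i \<inter> B j"
      using that by (auto simp: N_def)
    then have "p i j \<in> B i \<inter> B j"
      unfolding p_def by (rule someI_ex)
    then show ?thesis by simp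
  qed
  have finite_N: "finite (N i)" for i
    using \<open>finite I\<close> by (simp add: N_def)
  have N_ne: "N i \<noteq> {}" if "i \<in> I" for i
    using axis_box_nonempty[OF boxes[OF that]] that by (auto simp: N_def)
  have "cbox (a i) (b i) \<subseteq> B i" if i: "i \<in> I" for i
    using boxes[OF i]
  proof
    assume "open_axis_box (B i)"
    then obtain l u where B: "B i = box l u" by (auto simp: open_axis_box_def)
    have "l $ k < p i j $ k" "p i j $ k < u $ k" if "j \<in> N i" for j k
      using p_mem[OF that] by (simp_all add: B mem_box_cart)
    then have "l $ k < a i $ k" "b i $ k < u $ k" for k
      using finite_N N_ne[OF i] by (simp_all add: a_def b_def)
    then show ?thesis
      unfolding B by (simp add: subset_interval_imp_cart(2))
  next
    assume "closed_axis_box (B i)"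
    then obtain l u where B: "B i = cbox l u" by (auto simp: closed_axis_box_def)
    have "l $ k \<le> p i j $ k" "p i j $ k \<le> u $ k" if "j \<in> N i" for j k
      using p_mem[OF that] by (simp_all add: B mem_box_cart)
    then have "l $ k \<le> a i $ k" "b i $ k \<le> u $ k" for k
      using finite_N N_ne[OF i] by (simp_all add: a_def b_def)
    then show ?thesis
      unfolding B by (simp add: subset_interval_imp_cart(1))
  qed
  moreover have "a i $ k \<le> b j $ k" if "i \<in> I" "j \<in> I" "B i \<inter> B j \<noteq> {}" for i j k
  proof -
    have "j \<in> N i" "i \<in> N j"
      using that by (auto simp: N_def)
    then have "a i $ k \<le> p i j $ k" "p j i $ k \<le> b j $ k"
      using finite_N by (auto simp: a_def b_def)
    then show ?thesis
      by (simp add: p_commute)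
  qed
  ultimately show ?thesis by (rule that)
qed

text \<open>If meeting sets always have overlapping intervals, then no pair is both separated and
  intersecting, so the two kinds together fit into the two-element subsets of \<open>I\<close>.\<close>

lemma card_separated_pairs_le:
  assumes "finite I"
    and a_le_b: "\<And>i. i \<in> I \<Longrightarrow> a i \<le> b i"
    and meet: "\<And>i j. \<lbrakk>i \<in> I; j \<in> I; B i \<inter> B j \<noteq> {}\<rbrakk> \<Longrightarrow> a i \<le> b j"
  shows "card (separated_pairs a b I) + card (intersecting_pairs I B) \<le> card I choose 2"
proof -
  let ?P = "{s. s \<subseteq> I \<and> card s = 2}"
  have "finite ?P"
    using \<open>finite I\<close> by simp
  have sub_meet: "intersecting_pairs I B \<subseteq> ?P"
    by (auto simp: intersecting_pairs_def)
  have sub_sep: "separated_pairs a b I \<subseteq> ?P"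
    using a_le_b by (fastforce simp: separated_pairs_def card_2_iff)
  have "separated_pairs a b I \<inter> intersecting_pairs I B = {}"
  proof -
    have "B i \<inter> B j = {}" if "i \<in> I" "j \<in> I" "b i < a j" for i j
      using meet[of j i] that by force
    then show ?thesis
      by (auto simp: separated_pairs_def intersecting_pairs_def doubleton_eq_iff; blast)
  qed
  then have "card (separated_pairs a b I) + card (intersecting_pairs I B)
      = card (separated_pairs a b I \<union> intersecting_pairs I B)"
    using finite_subset[OF sub_meet \<open>finite ?P\<close>] finite_subset[OF sub_sep \<open>finite ?P\<close>]
    by (simp add: card_Un_disjoint)
  also have "\<dots> \<le> card ?P"
    using sub_meet sub_sep \<open>finite ?P\<close> by (intro card_mono) auto
  also have "\<dots> = card I choose 2"
    using n_subsets[OF \<open>finite I\<close>] by simp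
  finally show ?thesis .
qed

text \<open>The exact count \<open>(t + 1) choose 2\<close> matters: \<open>t choose 2\<close> on the left would leave an error
  term, whereas \<open>t\<^sup>2 \<le> (t + 1) t\<close> and \<open>n (n - 1) \<le> n\<^sup>2\<close> both lose in the right direction.\<close>

lemma le_sqrt_mult_of_choose_two_le:
  fixes c :: real and t n :: nat
  assumes "real (Suc t choose 2) \<le> c * real (n choose 2)" and "0 \<le> c"
  shows "real t \<le> sqrt c * real n"
proof -
  have two: "2 * real (m choose 2) = real m * (real m - 1)" for m
    by (induction m) (simp_all add: numeral_2_eq_2 algebra_simps)
  have "(real t)\<^sup>2 \<le> 2 * real (Suc t choose 2)"
    by (simp add: two power2_eq_square algebra_simps del: binomial_Suc_Suc)
  also have "\<dots> \<le> c * (2 * real (n choose 2))"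
    using assms(1) by simp
  also have "\<dots> \<le> c * (real n)\<^sup>2"
    using assms(2) by (intro mult_left_mono) (auto simp: two power2_eq_square algebra_simps)
  finally have "real t \<le> sqrt (c * (real n)\<^sup>2)"
    by (rule real_le_rsqrt)
  then show ?thesis
    by (simp add: real_sqrt_mult)
qed

theorem theorem2:
  fixes B :: "'i \<Rightarrow> (real ^ 'd) set" and I :: "'i set" and n :: nat and \<alpha> :: real
  assumes "finite I" and "card I = n" and "n \<ge> 1"
    and "(\<forall>i\<in>I. open_axis_box (B i)) \<or> (\<forall>i\<in>I. closed_axis_box (B i))"
    and "1 - 1 / (real CARD('d))\<^sup>2 < \<alpha>" and "\<alpha> \<le> 1"
    and "real (card (intersecting_pairs I B)) \<ge> \<alpha> * real (n choose 2)"
  shows "\<exists>x. real (card {i \<in> I. x \<in> B i}) \<ge> (1 - real CARD('d) * sqrt (1 - \<alpha>)) * real n"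
proof -
  obtain a b :: "'i \<Rightarrow> real ^ 'd" where
    sub: "\<And>i. i \<in> I \<Longrightarrow> cbox (a i) (b i) \<subseteq> B i" and
    meet: "\<And>i j k. \<lbrakk>i \<in> I; j \<in> I; B i \<inter> B j \<noteq> {}\<rbrakk> \<Longrightarrow> a i $ k \<le> b j $ k"
    using shrink_to_closed_boxes[OF \<open>finite I\<close>] assms(4) by metis
  have a_le_b: "a i $ k \<le> b i $ k" if "i \<in> I" for i k
    using meet[of i i k] axis_box_nonempty[of "B i"] assms(4) that by auto
  have "\<exists>y. real (card {i \<in> I. y \<notin> {a i $ k..b i $ k}}) \<le> sqrt (1 - \<alpha>) * real n" for k
  proof -
    let ?sep = "separated_pairs (\<lambda>i. a i $ k) (\<lambda>i. b i $ k) I"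
    obtain y where y: "Suc (card {i \<in> I. y \<notin> {a i $ k..b i $ k}}) choose 2 \<le> card ?sep"
      using exists_deep_point[OF \<open>finite I\<close>, of "\<lambda>i. a i $ k" "\<lambda>i. b i $ k"] a_le_b by blast
    have "card ?sep + card (intersecting_pairs I B) \<le> n choose 2"
      using card_separated_pairs_le[OF \<open>finite I\<close>, of "\<lambda>i. a i $ k" "\<lambda>i. b i $ k" B]
        a_le_b meet \<open>card I = n\<close> by blast
    then have "real (card ?sep) \<le> (1 - \<alpha>) * real (n choose 2)"
      using assms(7) by (simp add: algebra_simps flip: of_nat_add)
    then have "real (Suc (card {i \<in> I. y \<notin> {a i $ k..b i $ k}}) choose 2)
        \<le> (1 - \<alpha>) * real (n choose 2)"
      using y by linarith
    then show ?thesis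
      using le_sqrt_mult_of_choose_two_le \<open>\<alpha> \<le> 1\<close> by fastforce
  qed
  then have "\<exists>y. \<forall>k. real (card {i \<in> I. y k \<notin> {a i $ k..b i $ k}}) \<le> sqrt (1 - \<alpha>) * real n"
    by (intro choice allI)
  then obtain y where
    y: "\<And>k. real (card {i \<in> I. y k \<notin> {a i $ k..b i $ k}}) \<le> sqrt (1 - \<alpha>) * real n"
    by blast
  define x :: "real ^ 'd" where "x = (\<chi> k. y k)"
  let ?missed = "{i \<in> I. x \<notin> B i}"
  have "?missed \<subseteq> (\<Union>k. {i \<in> I. y k \<notin> {a i $ k..b i $ k}})"
  proof
    fix i
    assume "i \<in> ?missed"
    then have "i \<in> I" "x \<notin> cbox (a i) (b i)"
      using sub by blast+
    then show "i \<in> (\<Union>k. {i \<in> I. y k \<notin> {a i $ k..b i $ k}})"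
      by (simp add: x_def mem_box_cart)
  qed
  then have "card ?missed \<le> card (\<Union>k. {i \<in> I. y k \<notin> {a i $ k..b i $ k}})"
    using \<open>finite I\<close> by (intro card_mono) auto
  also have "\<dots> \<le> (\<Sum>k\<in>UNIV. card {i \<in> I. y k \<notin> {a i $ k..b i $ k}})"
    by (intro card_UN_le) simp
  finally have "real (card ?missed) \<le> (\<Sum>k\<in>UNIV. real (card {i \<in> I. y k \<notin> {a i $ k..b i $ k}}))"
    by (simp flip: of_nat_sum)
  also have "\<dots> \<le> real CARD('d) * (sqrt (1 - \<alpha>) * real n)"
    using y by (intro sum_bounded_above) auto
  finally have missed: "real (card ?missed) \<le> real CARD('d) * sqrt (1 - \<alpha>) * real n"
    by (simp add: mult.assoc)
  have "n = card {i \<in> I. x \<in> B i} + card ?missed"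
    unfolding \<open>card I = n\<close>[symmetric] using \<open>finite I\<close>
    by (subst card_Un_disjoint[symmetric]) (auto intro: arg_cong[where f = card])
  with missed show ?thesis
    by (intro exI[of _ x]) (simp add: algebra_simps)
qed

end
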